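(* Let $n\geq 3$ be an integer and let $p$ be a real number with $2\leq p<n$. Let $\Phi_{n}\in\mathbb{S}^{n}$ be an arbitrary point and let $d=d(\cdot,\Phi_n):\mathbb{S}^n\to[0,\pi]$ be the geodesic distance from $\Phi_n$ on $\mathbb{S}^n$. Then for every $u\in C^{\infty}(\mathbb{S}^{n})$, $$\int_{\mathbb{S}^{n}}\left|\nabla_{\mathbb{S}^{n}} u\right|^{p}d\sigma_{n}+(p-1)\left(\frac{n-p}{p}\right)^{p-1}\int_{\mathbb{S}^{n}}\frac{|u|^{p}}{|\tan d|^{p-2}}\,d\sigma_{n}\;\geq\;\left(\frac{n-p}{p}\right)^{p}\int_{\mathbb{S}^{n}}\frac{|u|^{p}}{|\tan d|^{p}}\,d\sigma_{n}.$$
   Context: $\mathbb{S}^{n}$ is the unit sphere in $\mathbb{R}^{n+1}$ and $\sigma_n$ is its surface measure. $C^\infty(\mathbb{S}^n)$ denotes the smooth real-valued functions on $\mathbb{S}^n$, and $\nabla_{\mathbb{S}^n}$ is the surface (Riemannian) gradient for the standard round metric. For $x,\Phi_n\in\mathbb{S}^n$ the geodesic distance is $d(x,\Phi_n)=\arccos\left(\sum_{m=1}^{n+1}x_m(\Phi_n)_m\right)\in[0,\pi]$, where $x_m$ and $(\Phi_n)_m$ are the Cartesian coordinates of $x$ and $\Phi_n$ in $\mathbb{R}^{n+1}$. For $0<d<\pi$, $1/|\tan d|$ is understood as $|\cos d|/\sin d$, and $1/|\tan d|^{0}=1$ when $p=2$. The points $\pm\Phi_n$, where $\sin d=0$, form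 a set of measure zero. *)

theory Defs
  imports "HOL-Analysis.Analysis"
begin

section \<open>Smooth functions on the unit sphere\<close>

text \<open>\<open>Ck_on k S f\<close> is meant for open \<open>S\<close>; it says that \<open>f\<close> is \<open>k\<close> times continuously
  differentiable on \<open>S\<close>. Differentiability is required at every level and continuity at the last.\<close>

primrec Ck_on :: "nat \<Rightarrow> 'a::euclidean_space set \<Rightarrow> ('a \<Rightarrow> real) \<Rightarrow> bool" where
  "Ck_on 0 S f \<longleftrightarrow> continuous_on S f"
| "Ck_on (Suc k) S f \<longleftrightarrow>
     (\<forall>x\<in>S. f differentiable (at x)) \<and>
     (\<forall>v. Ck_on k S (\<lambda>x. frechet_derivative f (at x) v))"

definition smooth_on :: "'a::euclidean_space set \<Rightarrow> ('a \<Rightarrow> real) \<Rightarrow> bool" where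
  "smooth_on S f \<longleftrightarrow> (\<forall>k. Ck_on k S f)"

text \<open>Smoothness on the embedded submanifold \<open>sphere 0 1\<close>: locally the restriction of a smooth
  function on an open subset of the ambient space. Only the values of \<open>u\<close> on the sphere matter.\<close>

definition smooth_on_sphere :: "('a::euclidean_space \<Rightarrow> real) \<Rightarrow> bool" where
  "smooth_on_sphere u \<longleftrightarrow>
     (\<forall>x\<in>sphere 0 1. \<exists>U F. open U \<and> x \<in> U \<and> smooth_on U F \<and> (\<forall>y\<in>U \<inter> sphere 0 1. u y = F y))"

section \<open>The surface gradient\<close>

text \<open>The Riemannian gradient for the metric induced from the ambient inner product: the tangent
  vector at \<open>x\<close> (so orthogonal to \<open>x\<close>) that represents the derivative of \<open>u\<close> along the sphere.
  Derivatives within the sphere are unique only on tangent vectors, so the condition \<open>g \<bullet> x = 0\<close>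
  is what makes the description definite.\<close>

definition sphere_gradient :: "('a::euclidean_space \<Rightarrow> real) \<Rightarrow> 'a \<Rightarrow> 'a" where
  "sphere_gradient u x =
     (THE g. g \<bullet> x = 0 \<and> (u has_derivative (\<lambda>h. g \<bullet> h)) (at x within sphere 0 1))"

lemma sphere_gradient_unique:
  fixes x :: "'a::euclidean_space"
  assumes x: "x \<in> sphere 0 1"
    and g1: "g1 \<bullet> x = 0" "(u has_derivative (\<lambda>h. g1 \<bullet> h)) (at x within sphere 0 1)"
    and g2: "g2 \<bullet> x = 0" "(u has_derivative (\<lambda>h. g2 \<bullet> h)) (at x within sphere 0 1)"
  shows "g1 = (g2 :: 'a)"
proof (rule ccontr)
  assume ne: "g1 \<noteq> g2"
  define v where "v = sgn (g1 - g2)"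
  define c where "c = (\<lambda>t::real. cos t *\<^sub>R x + sin t *\<^sub>R v)"
  have xx: "x \<bullet> x = 1" using x by (simp add: dot_square_norm)
  have vx: "v \<bullet> x = 0" using g1 g2 by (simp add: v_def sgn_div_norm inner_diff_left)
  have vv: "v \<bullet> v = 1" using ne by (simp add: v_def dot_square_norm norm_sgn)
  have "c t \<bullet> c t = 1" for t
  proof -
    have "c t \<bullet> c t = (cos t)\<^sup>2 * (x \<bullet> x) + (sin t)\<^sup>2 * (v \<bullet> v) + 2 * sin t * cos t * (v \<bullet> x)"
      by (simp add: c_def inner_add_left inner_add_right inner_commute power2_eq_square algebra_simps)
    then show ?thesis by (simp add: xx vv vx)
  qed
  then have c_sph: "range c \<subseteq> sphere 0 1" by (auto simp: norm_eq_sqrt_inner)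
  have c0: "c 0 = x" by (simp add: c_def)
  have cd: "(c has_derivative (\<lambda>t. t *\<^sub>R v)) (at 0)"
    unfolding c_def by (auto intro!: derivative_eq_intros)
  have d: "((\<lambda>y. u y - u y) has_derivative (\<lambda>h. g1 \<bullet> h - g2 \<bullet> h)) (at x within sphere 0 1)"
    by (intro has_derivative_diff g1 g2)
  have "((\<lambda>t. u (c t) - u (c t)) has_derivative (\<lambda>t. g1 \<bullet> (t *\<^sub>R v) - g2 \<bullet> (t *\<^sub>R v))) (at 0)"
    using has_derivative_in_compose[OF cd has_derivative_subset[OF d[folded c0] c_sph]] by simp
  then have "((\<lambda>t::real. 0::real) has_derivative (\<lambda>t. g1 \<bullet> (t *\<^sub>R v) - g2 \<bullet> (t *\<^sub>R v))) (at 0)"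
    by simp
  then have "(\<lambda>t. g1 \<bullet> (t *\<^sub>R v) - g2 \<bullet> (t *\<^sub>R v)) = (\<lambda>_. 0)"
    using has_derivative_unique has_derivative_const by blast
  then have "(g1 - g2) \<bullet> v = 0"
    by (metis inner_diff_left scaleR_one)
  then show False using ne
    by (simp add: v_def sgn_div_norm)
qed

lemma sphere_gradient_eq:
  fixes x :: "'a::euclidean_space"
  assumes x: "x \<in> sphere 0 1" and U: "open U" "x \<in> U"
    and F: "(F has_derivative (\<lambda>h. G \<bullet> h)) (at x)"
    and uF: "\<And>y. y \<in> U \<inter> sphere 0 1 \<Longrightarrow> u y = F y"
  shows "sphere_gradient u x = G - (G \<bullet> x) *\<^sub>R x"
proof -
  let ?g = "G - (G \<bullet> x) *\<^sub>R x"
  have xx: "x \<bullet> x = 1" using x by (simp add: dot_square_norm)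
  have t: "?g \<bullet> x = 0" by (simp add: inner_diff_left xx)
  have "((\<lambda>y. F y - (G \<bullet> x) * ((y \<bullet> y - 1) / 2)) has_derivative (\<lambda>h. ?g \<bullet> h))
          (at x within sphere 0 1)"
    by (rule derivative_eq_intros has_derivative_at_withinI[OF F] refl | simp)+
       (auto simp: fun_eq_iff inner_diff_left inner_commute algebra_simps)
  then have "(u has_derivative (\<lambda>h. ?g \<bullet> h)) (at x within sphere 0 1)"
  proof (rule has_derivative_transform_eventually)
    show "\<forall>\<^sub>F y in at x within sphere 0 1. F y - (G \<bullet> x) * ((y \<bullet> y - 1) / 2) = u y"
      using U unfolding eventually_at_topological by (auto simp: uF dot_square_norm)
  qed (use x U in \<open>auto simp: uF dot_square_norm\<close>)
  then show ?thesis
    unfolding sphere_gradient_def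
    using t sphere_gradient_unique[OF x] by (intro the_equality) blast+
qed

section \<open>Surface measure and geodesic distance\<close>

text \<open>Surface measure on the unit sphere by polar coordinates: \<open>DIM('a)\<close> times the Lebesgue
  volume of the cone over a set, see \<open>emeasure_sphere_measure\<close> below.\<close>

definition sphere_measure :: "'a::euclidean_space measure" where
  "sphere_measure =
     scale_measure (of_nat DIM('a))
       (distr (restrict_space lborel (ball 0 1 - {0})) (restrict_space borel (sphere 0 1))
          (\<lambda>x. x /\<^sub>R norm x))"

lemma space_sphere_measure [simp]: "space sphere_measure = sphere 0 1"
  by (simp add: sphere_measure_def space_scale_measure space_restrict_space)

lemma sets_sphere_measure [measurable_cong]:
  "sets sphere_measure = sets (restrict_space borel (sphere 0 1))"
  by (simp add: sphere_measure_def)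

lemma emeasure_sphere_measure:
  fixes A :: "'a::euclidean_space set"
  assumes A: "A \<in> sets borel" "A \<subseteq> sphere 0 1"
  shows "emeasure sphere_measure A =
    of_nat DIM('a) * emeasure lborel {r *\<^sub>R x | r x. 0 < r \<and> r < 1 \<and> x \<in> A}"
proof -
  let ?B = "ball 0 1 - {0} :: 'a set"
  let ?f = "\<lambda>x::'a. x /\<^sub>R norm x"
  have f: "?f \<in> measurable (restrict_space lborel ?B) (restrict_space borel (sphere 0 1))"
    by (intro measurable_restrict_space2) (auto simp: space_restrict_space intro!: measurable_restrict_space1)
  have A': "A \<in> sets (restrict_space borel (sphere 0 1))"
    using A by (auto simp: sets_restrict_space)
  have eq: "?f -` A \<inter> space (restrict_space lborel ?B) = {r *\<^sub>R x | r x. 0 < r \<and> r < 1 \<and> x \<in> A}"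
    (is "?L = ?R")
  proof (intro equalityI subsetI)
    fix y assume y: "y \<in> ?L"
    then have "y = norm y *\<^sub>R ?f y" "0 < norm y" "norm y < 1" "?f y \<in> A"
      by (auto simp: space_restrict_space)
    then show "y \<in> ?R" by blast
  next
    fix y assume "y \<in> ?R"
    then obtain r x where *: "y = r *\<^sub>R x" "0 < r" "r < 1" "x \<in> A" by blast
    moreover from * A have "norm x = 1" by auto
    ultimately show "y \<in> ?L" by (auto simp: space_restrict_space)
  qed
  have "emeasure sphere_measure A = of_nat DIM('a) * emeasure (restrict_space lborel ?B) ?R"
    unfolding sphere_measure_def emeasure_scale_measure emeasure_distr[OF f A'] eq ..
  also have "emeasure (restrict_space lborel ?B) ?R = emeasure lborel ?R"
    using eq by (intro emeasure_restrict_space) (auto simp: space_restrict_space)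
  finally show ?thesis .
qed

definition sphere_dist :: "'a::euclidean_space \<Rightarrow> 'a \<Rightarrow> real" where
  "sphere_dist x y = arccos (x \<bullet> y)"

text \<open>\<open>1 / |tan d| powr q\<close>, with \<open>1 / |tan d|\<close> read as \<open>|cos d| / sin d\<close>. The case distinction is
  needed because \<open>0 powr 0 = 0\<close>. Where \<open>sin d = 0\<close> the value for \<open>q \<noteq> 0\<close> is \<open>0\<close>.\<close>

definition inv_abs_tan_powr :: "real \<Rightarrow> real \<Rightarrow> real" where
  "inv_abs_tan_powr d q = (if q = 0 then 1 else (\<bar>cos d\<bar> / sin d) powr q)"

end

theory Submission
  imports Defs
begin

text \<open>Write \<open>s = x \<bullet> \<Phi> = cos d\<close> and let \<open>T = \<Phi> - s x\<close> be the tangential part of \<open>\<Phi>\<close>, so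
  \<open>T = - sin d \<nabla>d\<close> and \<open>div T = - n s\<close>. Integrating by parts against
  \<open>|u|\<^sup>p |cot d|\<^sup>p\<^sup>-\<^sup>2 cot d \<nabla>d\<close> and estimating the gradient term by Young's inequality gives the
  theorem. To avoid the poles, \<open>sin\<^sup>2 d = 1 - s\<^sup>2\<close> is replaced by \<open>1 - s\<^sup>2 + \<epsilon>\<close> in the weight;
  the estimate then keeps its constants, and \<open>\<epsilon> \<rightarrow> 0\<close> is Fatou's lemma.

  The divergence theorem is needed only for \<open>T\<close>. Since \<open>T\<close> is a combination of infinitesimal
  rotations, it follows from the rotation invariance of the surface measure by differentiating
  under the integral.\<close>

section \<open>Orthogonal invariance of Lebesgue measure\<close>

lemma nn_integral_lborel_translate:
  fixes f :: "'a::euclidean_space \<Rightarrow> ennreal"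
  assumes [measurable]: "f \<in> borel_measurable borel"
  shows "(\<integral>\<^sup>+y. f (z + y) \<partial>lborel) = (\<integral>\<^sup>+y. f y \<partial>lborel)"
proof -
  have "(\<integral>\<^sup>+y. f y \<partial>lborel) = (\<integral>\<^sup>+y. f y \<partial>distr lborel borel ((+) z))"
    by (simp only: lborel_distr_plus)
  also have "\<dots> = (\<integral>\<^sup>+y. f (z + y) \<partial>lborel)"
    by (rule nn_integral_distr) auto
  finally show ?thesis ..
qed

lemma nn_integral_lborel_reflect:
  fixes f :: "'a::euclidean_space \<Rightarrow> ennreal"
  assumes [measurable]: "f \<in> borel_measurable borel"
  shows "(\<integral>\<^sup>+y. f (z - y) \<partial>lborel) = (\<integral>\<^sup>+y. f y \<partial>lborel)"
proof -
  have "lborel = distr lborel borel (\<lambda>y::'a. z - y)"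
    using lborel_affine[of "-1" z] by (simp add: density_1)
  then have "(\<integral>\<^sup>+y. f y \<partial>lborel) = (\<integral>\<^sup>+y. f y \<partial>distr lborel borel (\<lambda>y. z - y))"
    by simp
  also have "\<dots> = (\<integral>\<^sup>+y. f (z - y) \<partial>lborel)"
    by (rule nn_integral_distr) auto
  finally show ?thesis ..
qed

text \<open>The library has this only over well-ordered index types. The argument is uniqueness of
  translation-invariant measures: by Tonelli \<open>\<lambda>(R\<^sup>-\<^sup>1 A) \<lambda>(B) = \<lambda>(R\<^sup>-\<^sup>1 B) \<lambda>(A)\<close>, and
  the unit ball is an invariant choice of \<open>B\<close>.\<close>

lemma lborel_distr_orthogonal:
  fixes R :: "'a::euclidean_space \<Rightarrow> 'a"
  assumes R: "orthogonal_transformation R"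
  shows "distr lborel borel R = lborel"
proof (rule measure_eqI)
  have lin: "linear R" and nR: "norm (R x) = norm x" for x
    using R by (auto simp: orthogonal_transformation)
  have [measurable]: "R \<in> borel_measurable borel"
    by (intro borel_measurable_continuous_onI linear_continuous_on linear_conv_bounded_linear[THEN iffD1] lin)
  fix A assume "A \<in> sets (distr lborel borel R)"
  then have [measurable]: "A \<in> sets borel" by simp
  define B where "B = ball (0::'a) 1"
  have [measurable]: "B \<in> sets borel" by (simp add: B_def)
  have B: "emeasure lborel B \<noteq> 0" "emeasure lborel B \<noteq> \<infinity>"
    using unit_ball_vol_pos[of "real DIM('a)", THEN less_imp_neq]
    by (auto simp: B_def emeasure_ball)
  have RB: "indicator B (R x) = (indicator B x :: ennreal)" for x
    by (simp add: B_def nR indicator_def)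
  let ?I = "\<lambda>S x. indicator S x :: ennreal"
  have "emeasure (distr lborel borel R) A * emeasure lborel B
      = (\<integral>\<^sup>+x. ?I A (R x) * emeasure lborel B \<partial>lborel)"
  proof -
    have "emeasure (distr lborel borel R) A = (\<integral>\<^sup>+x. ?I A x \<partial>distr lborel borel R)"
      by (rule nn_integral_indicator[symmetric]) simp
    also have "\<dots> = (\<integral>\<^sup>+x. ?I A (R x) \<partial>lborel)"
      by (rule nn_integral_distr) auto
    finally show ?thesis by (subst nn_integral_multc) auto
  qed
  also have "\<dots> = (\<integral>\<^sup>+x. (\<integral>\<^sup>+y. ?I A (R x) * ?I B (R x + y) \<partial>lborel) \<partial>lborel)"
    by (simp add: nn_integral_cmult nn_integral_lborel_translate[where f = "?I B"])
  also have "\<dots> = (\<integral>\<^sup>+y. (\<integral>\<^sup>+x. ?I A (R x) * ?I B (R x + y) \<partial>lborel) \<partial>lborel)"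
    by (rule lborel_pair.Fubini') measurable
  also have "\<dots> = (\<integral>\<^sup>+y. (\<integral>\<^sup>+x. ?I A (R x - y) * ?I B (R x) \<partial>lborel) \<partial>lborel)"
  proof (rule nn_integral_cong)
    fix y
    \<comment> \<open>Shifting \<open>x\<close> by this \<open>z\<close> moves the translation from
      the factor for \<open>B\<close> to the factor for \<open>A\<close>. The integral over
      \<open>y\<close> is then a reflected integral of the indicator of \<open>A\<close>, which does
      not depend on \<open>x\<close>.\<close>
    obtain z where z: "R z = y"
      using orthogonal_transformation_surj[OF R] by (metis surjD)
    show "(\<integral>\<^sup>+x. ?I A (R x) * ?I B (R x + y) \<partial>lborel) = (\<integral>\<^sup>+x. ?I A (R x - y) * ?I B (R x) \<partial>lborel)"
      using nn_integral_lborel_translate[of "\<lambda>x. ?I A (R x - y) * ?I B (R x)" z]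
      by (simp add: linear_add[OF lin] z add.commute)
  qed
  also have "\<dots> = (\<integral>\<^sup>+x. (\<integral>\<^sup>+y. ?I A (R x - y) * ?I B (R x) \<partial>lborel) \<partial>lborel)"
    by (rule lborel_pair.Fubini'[symmetric]) measurable
  also have "\<dots> = (\<integral>\<^sup>+x. emeasure lborel A * ?I B x \<partial>lborel)"
    by (simp add: nn_integral_multc nn_integral_lborel_reflect[where f = "?I A"] RB)
  also have "\<dots> = emeasure lborel A * emeasure lborel B"
    by (simp add: nn_integral_cmult)
  finally show "emeasure (distr lborel borel R) A = emeasure lborel A"
    using B by (simp add: mult.commute[of _ "emeasure lborel B"] ennreal_mult_cancel_left)
qed simp

section \<open>Rotation invariance and finiteness of the surface measure\<close>

text \<open>Since \<open>R\<close> is linear and preserves norms, the preimage under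
  \<open>R\<close> of the cone over \<open>A\<close> is the cone over the preimage of
  \<open>A\<close>. The surface measure is a multiple of the volume of cones, so its invariance
  reduces to that of Lebesgue measure.\<close>

lemma sphere_measure_distr_orthogonal:
  fixes R :: "'a::euclidean_space \<Rightarrow> 'a"
  assumes R: "orthogonal_transformation R"
  shows "R \<in> measurable sphere_measure sphere_measure"
    and "distr sphere_measure sphere_measure R = sphere_measure"
proof -
  let ?cone = "\<lambda>A::'a set. {r *\<^sub>R x | r x. 0 < r \<and> r < 1 \<and> x \<in> A}"
  have lin: "linear R" and nR: "norm (R x) = norm x" for x
    using R by (auto simp: orthogonal_transformation)
  have Rb: "R \<in> borel_measurable borel"
    by (intro borel_measurable_continuous_onI linear_continuous_on linear_conv_bounded_linear[THEN iffD1] lin)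
  show meas: "R \<in> measurable sphere_measure sphere_measure"
    unfolding measurable_cong_sets[OF sets_sphere_measure sets_sphere_measure]
    by (intro measurable_restrict_space2 measurable_restrict_space1 Rb)
       (auto simp: space_restrict_space nR)
  \<comment> \<open>As a preimage under radial projection, the cone over a Borel set is Borel, and
    its preimage under \<open>R\<close> can be computed.\<close>
  have cone_eq: "?cone A = (\<lambda>x. x /\<^sub>R norm x) -` A \<inter> (ball 0 1 - {0})"
    if "A \<subseteq> sphere 0 1" for A :: "'a set"
  proof (intro equalityI subsetI)
    fix y assume y: "y \<in> (\<lambda>x. x /\<^sub>R norm x) -` A \<inter> (ball 0 1 - {0})"
    then have "y = norm y *\<^sub>R (y /\<^sub>R norm y)" "0 < norm y" "norm y < 1" "y /\<^sub>R norm y \<in> A"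
      by auto
    then show "y \<in> ?cone A" by blast
  next
    fix y assume "y \<in> ?cone A"
    then obtain r x where *: "y = r *\<^sub>R x" "0 < r" "r < 1" "x \<in> A" by blast
    moreover from * that have "norm x = 1" by auto
    ultimately show "y \<in> (\<lambda>x. x /\<^sub>R norm x) -` A \<inter> (ball 0 1 - {0})" by auto
  qed
  have cone_borel: "?cone A \<in> sets borel" if "A \<in> sets borel" "A \<subseteq> sphere 0 1" for A :: "'a set"
  proof -
    have "(\<lambda>x::'a. x /\<^sub>R norm x) -` A \<inter> space borel \<in> sets borel"
      by (rule measurable_sets[OF _ that(1)]) simp
    then show ?thesis unfolding cone_eq[OF that(2)] by auto
  qed
  show "distr sphere_measure sphere_measure R = sphere_measure"
  proof (rule measure_eqI)
    fix A :: "'a set"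
    assume "A \<in> sets (distr sphere_measure sphere_measure R)"
    then have As: "A \<in> sets sphere_measure" by simp
    then have A: "A \<in> sets borel" "A \<subseteq> sphere 0 1"
      by (auto simp: sets_sphere_measure sets_restrict_space)
    define C where "C = R -` A"
    have C: "C \<in> sets borel" "C \<subseteq> sphere 0 1"
    proof -
      show "C \<in> sets borel" using measurable_sets[OF Rb A(1)] by (simp add: C_def)
      show "C \<subseteq> sphere 0 1"
      proof
        fix x assume "x \<in> C"
        then have "R x \<in> sphere 0 1" using A(2) by (auto simp: C_def)
        then show "x \<in> sphere 0 1" by (simp add: nR)
      qed
    qed
    have Rz: "R x = 0 \<longleftrightarrow> x = 0" for x
      by (metis nR norm_eq_zero)
    have im: "R -` ?cone A = ?cone C"
      unfolding cone_eq[OF A(2)] cone_eq[OF C(2)]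
      by (auto simp: C_def nR linear_scale[OF lin] Rz)
    have "emeasure lborel (?cone A) = emeasure (distr lborel borel R) (?cone A)"
      by (simp add: lborel_distr_orthogonal[OF R])
    also have "\<dots> = emeasure lborel (?cone C)"
      using emeasure_distr[of R lborel borel "?cone A"] Rb cone_borel[OF A]
      unfolding im by (simp only: space_lborel space_borel Int_UNIV_right measurable_lborel1 measurable_lborel2)
    finally have cone: "emeasure lborel (?cone A) = emeasure lborel (?cone C)" .
    have "R -` A \<inter> space sphere_measure = C" using C(2) by (auto simp: C_def)
    then have "emeasure (distr sphere_measure sphere_measure R) A = emeasure sphere_measure C"
      by (simp add: emeasure_distr[OF meas As])
    also have "\<dots> = emeasure sphere_measure A"
      by (simp add: emeasure_sphere_measure[OF A] emeasure_sphere_measure[OF C] cone)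
    finally show "emeasure (distr sphere_measure sphere_measure R) A = emeasure sphere_measure A" .
  qed simp
qed

lemma finite_measure_sphere_measure: "finite_measure (sphere_measure :: 'a::euclidean_space measure)"
proof
  let ?C = "{r *\<^sub>R x | r x. 0 < r \<and> r < 1 \<and> x \<in> sphere (0::'a) 1}"
  have "emeasure lborel ?C \<le> emeasure lborel (ball (0::'a) 1)"
    by (intro emeasure_mono) auto
  also have "\<dots> < \<infinity>" by (intro emeasure_bounded_finite) auto
  finally show "emeasure sphere_measure (space sphere_measure :: 'a set) \<noteq> \<infinity>"
    by (simp add: emeasure_sphere_measure ennreal_mult_eq_top_iff)
qed

lemma borel_measurable_sphere_measure:
  fixes f :: "'a::euclidean_space \<Rightarrow> 'b::topological_space"
  assumes "continuous_on (sphere 0 1) f"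
  shows "f \<in> borel_measurable sphere_measure"
  using borel_measurable_continuous_on_restrict[OF assms]
  by (simp add: measurable_cong_sets[OF sets_sphere_measure refl])

lemma integrable_sphere_measure:
  fixes f :: "'a::euclidean_space \<Rightarrow> real"
  assumes "continuous_on (sphere 0 1) f"
  shows "integrable sphere_measure f"
proof -
  have "bounded (f ` sphere 0 1)"
    by (intro compact_imp_bounded compact_continuous_image assms compact_sphere)
  then obtain B where "\<forall>x\<in>sphere 0 1. norm (f x) \<le> B"
    by (auto simp: bounded_iff)
  then show ?thesis
    by (intro finite_measure.integrable_const_bound[OF finite_measure_sphere_measure]
        borel_measurable_sphere_measure assms AE_I2) auto
qed

section \<open>Integration by parts on the sphere\<close>

text \<open>The field paired with \<open>g\<close> generates the rotations in the plane of
  \<open>a\<close> and \<open>c\<close>. By invariance the integral of \<open>F\<close> composed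
  with such a rotation does not depend on the angle, and its derivative at angle 0 is the integral
  in question.\<close>

lemma integral_rotation_derivative:
  fixes F :: "'a::euclidean_space \<Rightarrow> real"
  assumes F: "\<And>x. x \<in> sphere 0 1 \<Longrightarrow> (F has_derivative (\<lambda>h. g x \<bullet> h)) (at x within sphere 0 1)"
    and g: "continuous_on (sphere 0 1) g"
    and a: "norm a = 1" and c: "norm c = 1" and ac: "a \<bullet> c = 0"
  shows "(LINT x|sphere_measure. g x \<bullet> ((x \<bullet> c) *\<^sub>R a - (x \<bullet> a) *\<^sub>R c)) = 0"
proof -
  \<comment> \<open>\<open>R t\<close> rotates the plane of \<open>a\<close> and \<open>c\<close> by
    the angle \<open>t\<close>, from \<open>c\<close> towards \<open>a\<close>, and fixes the
    orthogonal complement. \<open>D\<close> is the derivative of \<open>F\<close> along this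
    flow.\<close>
  define R where "R t x = x + ((cos t - 1) * (x \<bullet> a) + sin t * (x \<bullet> c)) *\<^sub>R a
      + ((cos t - 1) * (x \<bullet> c) - sin t * (x \<bullet> a)) *\<^sub>R c" for t :: real and x :: "'a"
  define D where "D x = g x \<bullet> ((x \<bullet> c) *\<^sub>R a - (x \<bullet> a) *\<^sub>R c)" for x
  have aa: "a \<bullet> a = 1" and cc: "c \<bullet> c = 1" and ca: "c \<bullet> a = 0"
    using a c ac by (auto simp: dot_square_norm inner_commute)
  have Ra: "R t x \<bullet> a = cos t * (x \<bullet> a) + sin t * (x \<bullet> c)"
    and Rc: "R t x \<bullet> c = cos t * (x \<bullet> c) - sin t * (x \<bullet> a)" for t x
    by (simp_all add: R_def inner_add_left aa cc ac ca algebra_simps)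
  have orth: "orthogonal_transformation (R t)" for t
    unfolding orthogonal_transformation_def
  proof (intro conjI allI)
    show "linear (R t)"
      by (rule linearI) (simp_all add: R_def inner_add_left algebra_simps)
    fix v w
    \<comment> \<open>The identity is polynomial in \<open>cos t\<close> and \<open>sin t\<close>,
      taken as independent variables \<open>C\<close> and \<open>S\<close>; the relation
      \<open>C * C + S * S = 1\<close> enters only at the end.\<close>
    have poly: "d + ((C - 1) * va + S * vc) * wa + ((C - 1) * vc - S * va) * wc
        + ((C - 1) * wa + S * wc) * (C * va + S * vc) + ((C - 1) * wc - S * wa) * (C * vc - S * va)
      = d + (C * C + S * S - 1) * (va * wa + vc * wc)" for C S d va vc wa wc :: real
      by (simp add: algebra_simps)
    have "R t v \<bullet> R t w = R t v \<bullet> w + ((cos t - 1) * (w \<bullet> a) + sin t * (w \<bullet> c)) * (R t v \<bullet> a)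
        + ((cos t - 1) * (w \<bullet> c) - sin t * (w \<bullet> a)) * (R t v \<bullet> c)"
      by (simp add: R_def[of t w] inner_add_right)
    also have "R t v \<bullet> w = v \<bullet> w + ((cos t - 1) * (v \<bullet> a) + sin t * (v \<bullet> c)) * (w \<bullet> a)
        + ((cos t - 1) * (v \<bullet> c) - sin t * (v \<bullet> a)) * (w \<bullet> c)"
      by (simp add: R_def inner_add_left inner_commute[of a w] inner_commute[of c w])
    finally show "R t v \<bullet> R t w = v \<bullet> w"
      unfolding Ra Rc poly by (simp only: sin_cos_squared_add3) simp
  qed
  have Rsph: "R t x \<in> sphere 0 1" if "x \<in> sphere 0 1" for t x
    using orthogonal_transformation_norm[OF orth] that by simp
  have R0: "R 0 x = x" for x by (simp add: R_def)
  have der: "((\<lambda>t. F (R t x)) has_real_derivative D (R t x)) (at t)" if x: "x \<in> sphere 0 1" for x t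
  proof -
    have "((\<lambda>t. R t x) has_derivative (\<lambda>h. h *\<^sub>R ((R t x \<bullet> c) *\<^sub>R a - (R t x \<bullet> a) *\<^sub>R c))) (at t)"
      unfolding Ra Rc unfolding R_def
      by (rule derivative_eq_intros refl | simp)+ (auto simp: fun_eq_iff algebra_simps)
    moreover have "(\<lambda>t. R t x) ` UNIV \<subseteq> sphere 0 1" using Rsph[OF x] by blast
    ultimately have "((\<lambda>t. F (R t x)) has_derivative
        (\<lambda>h. g (R t x) \<bullet> (h *\<^sub>R ((R t x \<bullet> c) *\<^sub>R a - (R t x \<bullet> a) *\<^sub>R c)))) (at t)"
      using has_derivative_in_compose[of "\<lambda>t. R t x" _ t UNIV F]
        has_derivative_subset[OF F[OF Rsph[OF x]]] by blast
    then show ?thesis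
      by (simp add: has_field_derivative_def D_def mult_commute_abs)
  qed
  have Dcont: "continuous_on (sphere 0 1) D"
    unfolding D_def by (intro continuous_intros g)
  have Fcont: "continuous_on (sphere 0 1) F"
    using F has_derivative_continuous continuous_on_eq_continuous_within by blast
  have "bounded (D ` sphere 0 1)"
    by (intro compact_imp_bounded compact_continuous_image Dcont compact_sphere)
  then obtain B where B: "\<forall>x\<in>sphere 0 1. \<bar>D x\<bar> \<le> B"
    by (auto simp: bounded_iff)
  \<comment> \<open>By the mean value inequality, a bound for \<open>D\<close> dominates all
    difference quotients.\<close>
  have lip: "\<bar>F (R t x) - F x\<bar> \<le> B * \<bar>t\<bar>" if x: "x \<in> sphere 0 1" for t x
  proof -
    have "norm (F (R t x) - F (R 0 x)) \<le> B * norm (t - 0)"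
      by (rule field_differentiable_bound[of UNIV "\<lambda>t. F (R t x)" "\<lambda>t. D (R t x)"])
         (use der[OF x] B Rsph[OF x] in auto)
    then show ?thesis by (simp add: R0)
  qed
  \<comment> \<open>Difference quotients at the nonzero times \<open>1 / real (Suc n)\<close>, which
    tend to 0. Each has integral 0 by rotation invariance.\<close>
  define s where "s n x = (F (R (1 / real (Suc n)) x) - F x) / (1 / real (Suc n))" for n x
  have FR: "continuous_on (sphere 0 1) (\<lambda>x. F (R t x))" for t
    by (rule continuous_on_compose2[OF Fcont]) (use Rsph in \<open>auto simp: R_def intro!: continuous_intros\<close>)
  have "(\<lambda>n. integral\<^sup>L sphere_measure (s n)) \<longlonglongrightarrow> integral\<^sup>L sphere_measure D"
  proof (rule integral_dominated_convergence)
    show "D \<in> borel_measurable sphere_measure"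
      by (rule borel_measurable_sphere_measure[OF Dcont])
    show "s n \<in> borel_measurable sphere_measure" for n
      unfolding s_def by (intro borel_measurable_sphere_measure continuous_intros FR Fcont) auto
    show "integrable sphere_measure (\<lambda>x::'a. B)"
      by (intro integrable_sphere_measure continuous_intros)
    show "AE x in sphere_measure. (\<lambda>n. s n x) \<longlonglongrightarrow> D x"
    proof (rule AE_I2)
      fix x :: "'a" assume "x \<in> space sphere_measure"
      then have x: "x \<in> sphere 0 1" by simp
      have "((\<lambda>h. (F (R h x) - F x) / h) \<longlongrightarrow> D x) (at 0)"
        using der[OF x, of 0] by (simp add: DERIV_def R0)
      moreover have "filterlim (\<lambda>n. 1 / real (Suc n)) (at 0) sequentially"
        unfolding filterlim_at using LIMSEQ_inverse_real_of_nat by (simp add: inverse_eq_divide)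
      ultimately show "(\<lambda>n. s n x) \<longlonglongrightarrow> D x"
        unfolding s_def by (rule filterlim_compose)
    qed
    show "AE x in sphere_measure. norm (s n x) \<le> B" for n
    proof (rule AE_I2)
      fix x :: 'a assume "x \<in> space sphere_measure"
      then have "\<bar>F (R (1 / real (Suc n)) x) - F x\<bar> \<le> B * (1 / real (Suc n))"
        using lip[of x "1 / real (Suc n)"] by simp
      then show "norm (s n x) \<le> B"
        unfolding s_def real_norm_def abs_divide by (subst pos_divide_le_eq) auto
    qed
  qed
  moreover have "integral\<^sup>L sphere_measure (s n) = 0" for n
  proof -
    let ?R = "R (1 / real (Suc n))"
    have "integral\<^sup>L sphere_measure F = integral\<^sup>L (distr sphere_measure sphere_measure ?R) F"
      by (simp add: sphere_measure_distr_orthogonal[OF orth])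
    also have "\<dots> = (LINT x|sphere_measure. F (?R x))"
      by (intro integral_distr sphere_measure_distr_orthogonal[OF orth]
          borel_measurable_sphere_measure Fcont)
    finally show ?thesis
      unfolding s_def
      by (simp add: integral_diff integrable_sphere_measure FR Fcont)
  qed
  ultimately show ?thesis
    by (simp add: D_def[abs_def] LIMSEQ_const_iff)
qed

text \<open>The field is bilinear and alternating in \<open>a\<close> and \<open>b\<close>, so only
  the component \<open>c\<close> of \<open>b\<close> orthogonal to \<open>a\<close> contributes.
  Normalizing \<open>c\<close> gives the orthonormal case; if \<open>c = 0\<close> the field
  vanishes.\<close>

lemma integral_inner_rotation_field:
  fixes F :: "'a::euclidean_space \<Rightarrow> real"
  assumes F: "\<And>x. x \<in> sphere 0 1 \<Longrightarrow> (F has_derivative (\<lambda>h. g x \<bullet> h)) (at x within sphere 0 1)"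
    and g: "continuous_on (sphere 0 1) g" and a: "norm a = 1"
  shows "(LINT x|sphere_measure. g x \<bullet> ((x \<bullet> b) *\<^sub>R a - (x \<bullet> a) *\<^sub>R b)) = 0"
proof -
  define c where "c = b - (a \<bullet> b) *\<^sub>R a"
  have aa: "a \<bullet> a = 1" using a by (simp add: dot_square_norm)
  have eq: "(x \<bullet> b) *\<^sub>R a - (x \<bullet> a) *\<^sub>R b = norm c *\<^sub>R ((x \<bullet> sgn c) *\<^sub>R a - (x \<bullet> a) *\<^sub>R sgn c)" for x
  proof (cases "c = 0")
    case True
    then have "b = (a \<bullet> b) *\<^sub>R a" by (simp add: c_def)
    then obtain k where "b = k *\<^sub>R a" by blast
    then show ?thesis by (simp add: True algebra_simps)
  next
    case False
    then have "norm c *\<^sub>R ((x \<bullet> sgn c) *\<^sub>R a - (x \<bullet> a) *\<^sub>R sgn c) = (x \<bullet> c) *\<^sub>R a - (x \<bullet> a) *\<^sub>R c"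
      by (simp add: sgn_div_norm scaleR_diff_right mult.assoc[symmetric])
    then show ?thesis by (simp add: c_def algebra_simps)
  qed
  show ?thesis
  proof (cases "c = 0")
    case True
    then show ?thesis by (simp add: eq)
  next
    case False
    have "a \<bullet> sgn c = 0"
      by (simp add: sgn_div_norm c_def inner_diff_right aa)
    then have "(LINT x|sphere_measure. g x \<bullet> ((x \<bullet> sgn c) *\<^sub>R a - (x \<bullet> a) *\<^sub>R sgn c)) = 0"
      by (intro integral_rotation_derivative[where F = F] F g a) (auto simp: norm_sgn False)
    then show ?thesis unfolding eq inner_scaleR_right by simp
  qed
qed

text \<open>On the sphere \<open>a - (x \<bullet> a) x\<close> is the combination of the rotation fields
  \<open>(x \<bullet> b) a - (x \<bullet> a) b\<close> with coefficients \<open>x \<bullet> b\<close>, where \<open>b\<close> runs over the basis.\<close>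

lemma integral_sphere_by_parts:
  fixes F :: "'a::euclidean_space \<Rightarrow> real"
  assumes F: "\<And>x. x \<in> sphere 0 1 \<Longrightarrow> (F has_derivative (\<lambda>h. g x \<bullet> h)) (at x within sphere 0 1)"
    and g: "continuous_on (sphere 0 1) g" and a: "norm a = 1"
  shows "(LINT x|sphere_measure. g x \<bullet> (a - (x \<bullet> a) *\<^sub>R x)) =
    (real DIM('a) - 1) * (LINT x|sphere_measure. (x \<bullet> a) * F x)"
proof -
  have Fcont: "continuous_on (sphere 0 1) F"
    using F has_derivative_continuous continuous_on_eq_continuous_within by blast
  \<comment> \<open>By the product rule \<open>?g b x\<close> represents the derivative of
    \<open>(x \<bullet> b) * F x\<close>; it is paired with the rotation field
    \<open>?A b\<close>.\<close>
  let ?g = "\<lambda>b x. F x *\<^sub>R b + (x \<bullet> b) *\<^sub>R g x"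
  let ?A = "\<lambda>b x. (x \<bullet> b) *\<^sub>R a - (x \<bullet> a) *\<^sub>R b"
  have z: "(LINT x|sphere_measure. ?g b x \<bullet> ?A b x) = 0" for b
  proof (rule integral_inner_rotation_field[OF _ _ a])
    fix x :: "'a" assume x: "x \<in> sphere 0 1"
    show "((\<lambda>x. (x \<bullet> b) * F x) has_derivative (\<lambda>h. ?g b x \<bullet> h)) (at x within sphere 0 1)"
      by (rule derivative_eq_intros F[OF x] refl | simp)+
         (auto simp: fun_eq_iff inner_add_left inner_commute algebra_simps)
  qed (intro continuous_intros Fcont g)
  \<comment> \<open>In the sum over the basis, the terms with \<open>F\<close> give
    \<open>x \<bullet> a\<close> once and subtract it \<open>DIM('a)\<close> times, whence the
    factor \<open>DIM('a) - 1\<close>. The terms with \<open>g\<close> recombine to the tangential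
    part of \<open>a\<close> because \<open>x\<close> has norm 1.\<close>
  have pt: "(\<Sum>b\<in>Basis. ?g b x \<bullet> ?A b x) =
      g x \<bullet> (a - (x \<bullet> a) *\<^sub>R x) - (real DIM('a) - 1) * ((x \<bullet> a) * F x)"
    if x: "x \<in> sphere 0 1" for x
  proof -
    have xx: "(\<Sum>b\<in>Basis. (x \<bullet> b) * (x \<bullet> b)) = 1"
      using x by (simp add: euclidean_inner[symmetric] dot_square_norm)
    have xa: "(\<Sum>b\<in>Basis. (x \<bullet> b) * (a \<bullet> b)) = x \<bullet> a"
      by (simp add: euclidean_inner[symmetric])
    have gx: "(\<Sum>b\<in>Basis. (x \<bullet> b) * (g x \<bullet> b)) = g x \<bullet> x"
      by (simp add: euclidean_inner[of "g x" x] mult.commute)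
    have "(\<Sum>b\<in>Basis. ?g b x \<bullet> ?A b x) = (\<Sum>b\<in>Basis.
        F x * ((x \<bullet> b) * (a \<bullet> b)) - F x * (x \<bullet> a) + (g x \<bullet> a) * ((x \<bullet> b) * (x \<bullet> b))
          - (x \<bullet> a) * ((x \<bullet> b) * (g x \<bullet> b)))"
      by (intro sum.cong refl)
         (simp add: inner_add_left inner_diff_right inner_commute[of _ a] inner_Basis algebra_simps)
    also have "\<dots> = F x * (x \<bullet> a) - real DIM('a) * (F x * (x \<bullet> a)) + g x \<bullet> a
        - (x \<bullet> a) * (g x \<bullet> x)"
      unfolding sum.distrib sum_subtractf sum_distrib_left[symmetric] xx xa gx
      by simp
    also have "\<dots> = g x \<bullet> (a - (x \<bullet> a) *\<^sub>R x) - (real DIM('a) - 1) * ((x \<bullet> a) * F x)"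
      by (simp add: algebra_simps)
    finally show ?thesis .
  qed
  have "0 = (\<Sum>b\<in>Basis. (LINT x|sphere_measure. ?g b x \<bullet> ?A b x))" by (simp add: z)
  also have "\<dots> = (LINT x|sphere_measure. (\<Sum>b\<in>Basis. ?g b x \<bullet> ?A b x))"
    by (intro Bochner_Integration.integral_sum[symmetric] integrable_sphere_measure continuous_intros Fcont g)
  also have "\<dots> = (LINT x|sphere_measure.
      g x \<bullet> (a - (x \<bullet> a) *\<^sub>R x) - (real DIM('a) - 1) * ((x \<bullet> a) * F x))"
    by (intro Bochner_Integration.integral_cong refl pt) simp
  also have "\<dots> = (LINT x|sphere_measure. g x \<bullet> (a - (x \<bullet> a) *\<^sub>R x))
      - (real DIM('a) - 1) * (LINT x|sphere_measure. (x \<bullet> a) * F x)"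
    by (subst Bochner_Integration.integral_diff)
       (auto intro!: integrable_sphere_measure continuous_intros Fcont g)
  finally show ?thesis by simp
qed

section \<open>The surface gradient of a smooth function\<close>

text \<open>Near each point the surface gradient is the tangential projection of the ambient
  gradient of a smooth extension. This makes the definite description usable as a derivative and
  yields continuity.\<close>

lemma
  fixes u :: "'a::euclidean_space \<Rightarrow> real"
  assumes u: "smooth_on_sphere u"
  shows has_derivative_sphere_gradient: "x \<in> sphere 0 1 \<Longrightarrow>
      (u has_derivative (\<lambda>h. sphere_gradient u x \<bullet> h)) (at x within sphere 0 1)"
    and sphere_gradient_tangent: "x \<in> sphere 0 1 \<Longrightarrow> sphere_gradient u x \<bullet> x = 0"
    and continuous_on_sphere_gradient: "continuous_on (sphere 0 1) (sphere_gradient u)"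
proof -
  have main: "(u has_derivative (\<lambda>h. sphere_gradient u x \<bullet> h)) (at x within sphere 0 1) \<and>
      sphere_gradient u x \<bullet> x = 0 \<and> continuous (at x within sphere 0 1) (sphere_gradient u)"
    if x: "x \<in> sphere 0 1" for x
  proof -
    obtain U F where U: "open U" "x \<in> U" and F: "smooth_on U F"
      and uF: "\<And>y. y \<in> U \<inter> sphere 0 1 \<Longrightarrow> u y = F y"
      using u x unfolding smooth_on_sphere_def by metis
    have "Ck_on (Suc 0) U F" using F by (simp add: smooth_on_def)
    then have diff: "\<forall>y\<in>U. F differentiable (at y)"
      and cont: "\<And>v. continuous_on U (\<lambda>x. frechet_derivative F (at x) v)"
      by auto
    define G where "G y = (\<Sum>b\<in>Basis. frechet_derivative F (at y) b *\<^sub>R b)" for y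
    have G: "(F has_derivative (\<lambda>h. G y \<bullet> h)) (at y)" if "y \<in> U" for y
    proof -
      have d: "(F has_derivative frechet_derivative F (at y)) (at y)"
        using diff that frechet_derivative_works by blast
      then have lin: "linear (frechet_derivative F (at y))"
        using has_derivative_linear by blast
      have "frechet_derivative F (at y) h = G y \<bullet> h" for h
      proof -
        have "frechet_derivative F (at y) h = frechet_derivative F (at y) (\<Sum>b\<in>Basis. (h \<bullet> b) *\<^sub>R b)"
          by (simp add: euclidean_representation)
        also have "\<dots> = G y \<bullet> h"
          by (simp add: linear_sum[OF lin] linear_scale[OF lin] G_def inner_sum_left
              inner_commute[of h] mult.commute)
        finally show ?thesis .
      qed
      then have "frechet_derivative F (at y) = (\<lambda>h. G y \<bullet> h)" by blast
      with d show ?thesis by simp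
    qed
    have eq: "sphere_gradient u y = G y - (G y \<bullet> y) *\<^sub>R y" if "y \<in> U \<inter> sphere 0 1" for y
      using sphere_gradient_eq[of y U F "G y" u] that U G uF by auto
    have xx: "x \<bullet> x = 1" using x by (simp add: dot_square_norm)
    have gx: "sphere_gradient u x = G x - (G x \<bullet> x) *\<^sub>R x"
      using eq x U by blast
    have tang: "sphere_gradient u x \<bullet> x = 0"
      by (simp add: gx inner_diff_left xx)
    \<comment> \<open>The function \<open>(y \<bullet> y - 1) / 2\<close> vanishes on the sphere and
      has gradient \<open>x\<close> at \<open>x\<close>. Subtracting a multiple of it keeps the
      values on the sphere and removes the normal component of \<open>G x\<close>.\<close>
    have "((\<lambda>y. F y - (G x \<bullet> x) * ((y \<bullet> y - 1) / 2)) has_derivative (\<lambda>h. sphere_gradient u x \<bullet> h))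
            (at x within sphere 0 1)"
      by (rule derivative_eq_intros has_derivative_at_withinI[OF G[OF U(2)]] refl | simp)+
         (auto simp: gx fun_eq_iff inner_diff_left inner_commute algebra_simps)
    then have der: "(u has_derivative (\<lambda>h. sphere_gradient u x \<bullet> h)) (at x within sphere 0 1)"
    proof (rule has_derivative_transform_eventually)
      show "\<forall>\<^sub>F y in at x within sphere 0 1. F y - (G x \<bullet> x) * ((y \<bullet> y - 1) / 2) = u y"
        using U unfolding eventually_at_topological by (auto simp: uF dot_square_norm)
    qed (use x U in \<open>auto simp: uF dot_square_norm\<close>)
    have "continuous_on U G"
      unfolding G_def by (intro continuous_intros cont)
    then have "continuous_on (U \<inter> sphere 0 1) G"
      by (rule continuous_on_subset) auto
    then have "continuous_on (U \<inter> sphere 0 1) (\<lambda>y. G y - (G y \<bullet> y) *\<^sub>R y)"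
      by (intro continuous_intros)
    then have "continuous_on (U \<inter> sphere 0 1) (sphere_gradient u)"
      by (rule continuous_on_eq) (rule eq[symmetric])
    then have "continuous (at x within U \<inter> sphere 0 1) (sphere_gradient u)"
      using x U by (simp add: continuous_on_eq_continuous_within)
    moreover have "at x within U \<inter> sphere 0 1 = at x within sphere 0 1"
      by (rule at_within_nhd[OF U(2,1)]) auto
    ultimately show ?thesis using der tang by simp
  qed
  then show "x \<in> sphere 0 1 \<Longrightarrow>
      (u has_derivative (\<lambda>h. sphere_gradient u x \<bullet> h)) (at x within sphere 0 1)"
    and "x \<in> sphere 0 1 \<Longrightarrow> sphere_gradient u x \<bullet> x = 0"
    and "continuous_on (sphere 0 1) (sphere_gradient u)"
    by (auto simp: continuous_on_eq_continuous_within)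
qed

section \<open>Powers of absolute values and Young's inequality\<close>

lemma continuous_on_abs_powr:
  fixes f :: "'a::topological_space \<Rightarrow> real"
  assumes "continuous_on S f" "0 < r"
  shows "continuous_on S (\<lambda>x. \<bar>f x\<bar> powr r)"
  using assms by (intro continuous_on_powr' continuous_intros) auto

text \<open>The odd power is the difference of the powers of the positive and the negative part,
  both continuous, so the jump of \<open>sgn\<close> at 0 does no harm.\<close>

lemma continuous_on_abs_powr_sgn:
  fixes f :: "'a::topological_space \<Rightarrow> real"
  assumes "continuous_on S f" "0 < r"
  shows "continuous_on S (\<lambda>x. \<bar>f x\<bar> powr r * sgn (f x))"
proof -
  have "(\<lambda>x. \<bar>f x\<bar> powr r * sgn (f x)) = (\<lambda>x. (max (f x) 0) powr r - (max (- f x) 0) powr r)"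
    using assms by (auto simp: fun_eq_iff max_def sgn_if)
  moreover have "continuous_on S (\<lambda>x. (max (f x) 0) powr r - (max (- f x) 0) powr r)"
    using assms by (intro continuous_intros continuous_on_powr') auto
  ultimately show ?thesis by (simp only:)
qed

text \<open>Away from 0 this is the ordinary power rule up to sign. At 0 the difference quotient is
  \<open>\<bar>h\<bar> powr (r - 1) * sgn h\<close>, which tends to 0 because
  \<open>1 < r\<close>.\<close>

lemma DERIV_abs_powr:
  fixes t :: real
  assumes "1 < r"
  shows "((\<lambda>t. \<bar>t\<bar> powr r) has_real_derivative r * (\<bar>t\<bar> powr (r - 1) * sgn t)) (at t)"
proof -
  consider "t > 0" | "t < 0" | "t = 0" by linarith
  then show ?thesis
  proof cases
    case 1
    then have "((\<lambda>t. t powr r) has_real_derivative r * (\<bar>t\<bar> powr (r - 1) * sgn t)) (at t)"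
      by (auto intro!: derivative_eq_intros)
    then show ?thesis
      by (rule has_field_derivative_transform_within_open[of _ _ _ "{0<..}"]) (use 1 in auto)
  next
    case 2
    then have "((\<lambda>t. (- t) powr r) has_real_derivative r * (\<bar>t\<bar> powr (r - 1) * sgn t)) (at t)"
      by (auto intro!: derivative_eq_intros)
    then show ?thesis
      by (rule has_field_derivative_transform_within_open[of _ _ _ "{..<0}"]) (use 2 in auto)
  next
    case 3
    have "isCont (\<lambda>h::real. \<bar>h\<bar> powr (r - 1) * sgn h) 0"
      using continuous_on_abs_powr_sgn[OF continuous_on_id, of "r - 1" UNIV] assms
      by (simp add: continuous_on_eq_continuous_at)
    then have "((\<lambda>h::real. \<bar>h\<bar> powr (r - 1) * sgn h) \<longlongrightarrow> 0) (at 0)"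
      unfolding isCont_def by simp
    moreover have "\<forall>\<^sub>F h in at 0. \<bar>h\<bar> powr (r - 1) * sgn h = (\<bar>0 + h\<bar> powr r - \<bar>0\<bar> powr r) / h"
      unfolding eventually_at_filter by (intro always_eventually) (auto simp: powr_diff sgn_if)
    ultimately have "((\<lambda>h::real. (\<bar>0 + h\<bar> powr r - \<bar>0\<bar> powr r) / h) \<longlongrightarrow> 0) (at 0)"
      by (rule Lim_transform_eventually)
    then show ?thesis using 3 by (simp add: DERIV_def)
  qed
qed

text \<open>The case \<open>r = 1\<close>, which arises for \<open>p = 2\<close>, is separate: the
  function is then the identity with derivative 1, while \<open>\<bar>t\<bar> powr 0\<close> is 0 at
  \<open>t = 0\<close>.\<close>

lemma DERIV_abs_powr_sgn:
  fixes t :: real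
  assumes "1 \<le> r"
  shows "((\<lambda>t. \<bar>t\<bar> powr r * sgn t) has_real_derivative
    r * (if r = 1 then 1 else \<bar>t\<bar> powr (r - 1))) (at t)"
proof (cases "r = 1")
  case True
  have "(\<lambda>t::real. \<bar>t\<bar> powr r * sgn t) = (\<lambda>t. t)"
    by (auto simp: fun_eq_iff sgn_if True)
  then show ?thesis using True by simp
next
  case False
  consider "t > 0" | "t < 0" | "t = 0" by linarith
  then show ?thesis
  proof cases
    case 1
    then have "((\<lambda>t. t powr r) has_real_derivative r * \<bar>t\<bar> powr (r - 1)) (at t)"
      by (auto intro!: derivative_eq_intros)
    then have "((\<lambda>t. \<bar>t\<bar> powr r * sgn t) has_real_derivative r * \<bar>t\<bar> powr (r - 1)) (at t)"
      by (rule has_field_derivative_transform_within_open[of _ _ _ "{0<..}"]) (use 1 in auto)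
    then show ?thesis using False by simp
  next
    case 2
    then have "((\<lambda>t. - ((- t) powr r)) has_real_derivative r * \<bar>t\<bar> powr (r - 1)) (at t)"
      by (auto intro!: derivative_eq_intros)
    then have "((\<lambda>t. \<bar>t\<bar> powr r * sgn t) has_real_derivative r * \<bar>t\<bar> powr (r - 1)) (at t)"
      by (rule has_field_derivative_transform_within_open[of _ _ _ "{..<0}"]) (use 2 in auto)
    then show ?thesis using False by simp
  next
    case 3
    have "isCont (\<lambda>h::real. \<bar>h\<bar> powr (r - 1)) 0"
      using continuous_on_abs_powr[OF continuous_on_id, of "r - 1" UNIV] assms False
      by (simp add: continuous_on_eq_continuous_at)
    then have "((\<lambda>h::real. \<bar>h\<bar> powr (r - 1)) \<longlongrightarrow> 0) (at 0)"
      unfolding isCont_def by simp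
    moreover have "\<forall>\<^sub>F h in at 0. \<bar>h\<bar> powr (r - 1) = (\<bar>0 + h\<bar> powr r * sgn (0 + h) - \<bar>0\<bar> powr r * sgn 0) / h"
      unfolding eventually_at_filter by (intro always_eventually) (auto simp: powr_diff sgn_if)
    ultimately have "((\<lambda>h::real. (\<bar>0 + h\<bar> powr r * sgn (0 + h) - \<bar>0\<bar> powr r * sgn 0) / h) \<longlongrightarrow> 0) (at 0)"
      by (rule Lim_transform_eventually)
    then show ?thesis using 3 False by (simp add: DERIV_def)
  qed
qed

text \<open>Young's inequality with conjugate exponents \<open>p\<close> and
  \<open>p / (p - 1)\<close> for \<open>a\<close> and \<open>b powr (p - 1)\<close>, multiplied by
  \<open>p\<close>.\<close>

lemma Youngs_inequality_weight:
  fixes a b p :: real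
  assumes "1 < p" "0 \<le> a" "0 \<le> b"
  shows "p * (a * b powr (p - 1)) \<le> a powr p + (p - 1) * b powr p"
proof -
  have "a * b powr (p - 1) \<le> a powr p / p + (b powr (p - 1)) powr (p / (p - 1)) / (p / (p - 1))"
    using assms by (intro Youngs_inequality) (auto simp: field_simps)
  also have "(b powr (p - 1)) powr (p / (p - 1)) = b powr p"
    using assms by (simp add: powr_powr)
  finally show ?thesis using assms by (simp add: field_simps)
qed

section \<open>The inequality with regularized weight\<close>

text \<open>Integration by parts is applied to
  \<open>\<bar>u x\<bar> powr p * h (x \<bullet> \<Phi>)\<close> along the tangential part of
  \<open>\<Phi>\<close>. For \<open>0 < e\<close> all integrands are continuous, so the integrals
  are finite and terms may be subtracted.\<close>

lemma sphere_hardy_regularized: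
  fixes \<Phi> :: "'a::euclidean_space" and u :: "'a \<Rightarrow> real" and p e :: real
  defines "\<gamma> \<equiv> (real DIM('a) - 1 - p) / p"
  assumes p: "2 \<le> p" "p < real DIM('a) - 1" and \<Phi>: "\<Phi> \<in> sphere 0 1" and e: "0 < e"
    and u: "smooth_on_sphere u"
  shows "\<gamma> powr p * (LINT x|sphere_measure. (\<bar>u x\<bar> * \<bar>x \<bullet> \<Phi>\<bar> / sqrt (1 - (x \<bullet> \<Phi>)\<^sup>2 + e)) powr p)
    \<le> (LINT x|sphere_measure. norm (sphere_gradient u x) powr p)
      + (p - 1) * \<gamma> powr (p - 1) * (LINT x|sphere_measure.
          \<bar>u x\<bar> powr p * (if p = 2 then 1 else \<bar>x \<bullet> \<Phi>\<bar> powr (p - 2))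
            * ((1 - (x \<bullet> \<Phi>)\<^sup>2) / (1 - (x \<bullet> \<Phi>)\<^sup>2 + e) powr (p / 2)))"
proof -
  \<comment> \<open>The case \<open>p = 2\<close> is separate because \<open>0 powr 0 = 0\<close>,
    whereas the weight must be 1.\<close>
  define w :: "real \<Rightarrow> real" where "w t = (if p = 2 then 1 else \<bar>t\<bar> powr (p - 2))" for t
  define D where "D t = 1 - t\<^sup>2 + e" for t
  \<comment> \<open>For \<open>e = 0\<close> and \<open>t = cos d\<close> this is
    \<open>\<bar>cot d\<bar> powr (p - 2) * cot d / sin d\<close>. The division by
    \<open>sin d\<close> compensates for the norm \<open>sin d\<close> of the tangential part of
    \<open>\<Phi>\<close>.\<close>
  define h where "h t = \<bar>t\<bar> powr (p - 1) * sgn t * D t powr (- p / 2)" for t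
  define h' where "h' t = (p - 1) * w t * D t powr (- p / 2)
      + p * (\<bar>t\<bar> powr p * D t powr (- p / 2 - 1))" for t
  \<comment> \<open>\<open>b\<close> and \<open>K\<close> are the regularized forms of
    \<open>\<bar>u\<bar> / \<bar>tan d\<bar>\<close> and
    \<open>\<bar>u\<bar> powr p / \<bar>tan d\<bar> powr (p - 2)\<close>.\<close>
  define b where "b x = \<bar>u x\<bar> * \<bar>x \<bullet> \<Phi>\<bar> / sqrt (D (x \<bullet> \<Phi>))" for x
  define K where "K x = \<bar>u x\<bar> powr p * w (x \<bullet> \<Phi>) * ((1 - (x \<bullet> \<Phi>)\<^sup>2) / D (x \<bullet> \<Phi>) powr (p / 2))" for x
  let ?S = "sphere (0::'a) 1"
  let ?a = "\<lambda>x. norm (sphere_gradient u x)"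
  define g where "g x = (p * (\<bar>u x\<bar> powr (p - 1) * sgn (u x)) * h (x \<bullet> \<Phi>)) *\<^sub>R sphere_gradient u x
      + (\<bar>u x\<bar> powr p * h' (x \<bullet> \<Phi>)) *\<^sub>R \<Phi>" for x
  have \<gamma>: "0 < \<gamma>" and p\<gamma>: "p * \<gamma> = real DIM('a) - 1 - p" using p by (auto simp: \<gamma>_def)
  have n\<Phi>: "norm \<Phi> = 1" using \<Phi> by simp
  have s1: "(x \<bullet> \<Phi>)\<^sup>2 \<le> 1" if "x \<in> ?S" for x
    using Cauchy_Schwarz_ineq[of x \<Phi>] that n\<Phi> by (simp add: dot_square_norm)
  have D0: "0 < D (x \<bullet> \<Phi>)" and D1: "1 - (x \<bullet> \<Phi>)\<^sup>2 \<le> D (x \<bullet> \<Phi>)" if "x \<in> ?S" for x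
    using s1[OF that] e by (auto simp: D_def)
  note cg = continuous_on_sphere_gradient[OF u]
  have cu: "continuous_on ?S u"
    using has_derivative_sphere_gradient[OF u] has_derivative_continuous
      continuous_on_eq_continuous_within by blast
  have cs: "continuous_on ?S (\<lambda>x. x \<bullet> \<Phi>)" by (intro continuous_intros)
  have cD: "continuous_on ?S (\<lambda>x. D (x \<bullet> \<Phi>))" unfolding D_def by (intro continuous_intros)
  have cDr: "continuous_on ?S (\<lambda>x. D (x \<bullet> \<Phi>) powr r)" for r
    using D0 by (intro continuous_on_powr continuous_intros cD) force
  note cabs = continuous_on_abs_powr and csgn = continuous_on_abs_powr_sgn
  have cw: "continuous_on ?S (\<lambda>x. w (x \<bullet> \<Phi>))"
    unfolding w_def using p by (cases "p = 2") (auto intro!: cabs cs)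
  have ch: "continuous_on ?S (\<lambda>x. h (x \<bullet> \<Phi>))"
    unfolding h_def using p by (intro continuous_on_mult csgn cs cDr) auto
  have ch': "continuous_on ?S (\<lambda>x. h' (x \<bullet> \<Phi>))"
    unfolding h'_def using p
    by (intro continuous_on_add continuous_on_mult continuous_on_const cw cabs cs cDr) auto
  have cgg: "continuous_on ?S g"
    unfolding g_def using p
    by (intro continuous_on_add continuous_on_scaleR continuous_on_mult csgn cabs cu ch ch' cg
        continuous_on_const) auto
  have ca: "continuous_on ?S (\<lambda>x. ?a x powr p)"
    using cabs[of ?S ?a p] cg p by (simp add: continuous_on_norm)
  have cb: "continuous_on ?S b"
  proof -
    have "sqrt (D (x \<bullet> \<Phi>)) \<noteq> 0" if "x \<in> ?S" for x using D0[OF that] by simp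
    then show ?thesis
      unfolding b_def
      by (intro continuous_on_divide continuous_on_mult continuous_on_rabs continuous_on_real_sqrt
          cu cs cD) auto
  qed
  have b0: "0 \<le> b x" if "x \<in> ?S" for x
    using D0[OF that] by (simp add: b_def)
  have cbp: "continuous_on ?S (\<lambda>x. b x powr p)"
  proof -
    have "continuous_on ?S (\<lambda>x. \<bar>b x\<bar> powr p)" using p by (intro cabs cb) simp
    then show ?thesis by (rule continuous_on_eq) (use b0 in auto)
  qed
  have cK: "continuous_on ?S K"
  proof -
    have "D (x \<bullet> \<Phi>) powr (p / 2) \<noteq> 0" if "x \<in> ?S" for x using D0[OF that] by simp
    then show ?thesis
      unfolding K_def using p
      by (intro continuous_on_mult continuous_on_divide continuous_on_diff continuous_on_power
          continuous_on_const cabs cu cw cs cDr) auto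
  qed
  have h_der: "(h has_real_derivative h' t) (at t)" if t: "0 < D t" for t
  proof -
    have "((\<lambda>t. \<bar>t\<bar> powr (p - 1) * sgn t * D t powr (- p / 2)) has_real_derivative
        (\<bar>t\<bar> powr (p - 1) * sgn t) * ((- p / 2) * D t powr (- p / 2 - 1) * (- 2 * t))
        + (p - 1) * (if p - 1 = 1 then 1 else \<bar>t\<bar> powr (p - 1 - 1)) * D t powr (- p / 2)) (at t)"
    proof (rule DERIV_mult'[OF DERIV_abs_powr_sgn])
      have "(D has_real_derivative - 2 * t) (at t)"
        unfolding D_def by (auto intro!: derivative_eq_intros)
      then show "((\<lambda>t. D t powr (- p / 2)) has_real_derivative
          (- p / 2) * D t powr (- p / 2 - 1) * (- 2 * t)) (at t)"
        by (rule DERIV_chain2[of "\<lambda>z. z powr (- p / 2)" _ D t, OF has_real_derivative_powr[OF t]])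
    qed (use p in simp)
    moreover have "\<bar>t\<bar> powr (p - 1) * sgn t * t = \<bar>t\<bar> powr p"
      by (cases "t = 0") (auto simp: powr_diff sgn_if)
    then have "(\<bar>t\<bar> powr (p - 1) * sgn t) * ((- p / 2) * D t powr (- p / 2 - 1) * (- 2 * t))
        = p * (\<bar>t\<bar> powr p * D t powr (- p / 2 - 1))"
      by (simp add: algebra_simps)
    moreover have "(if p - 1 = 1 then 1 else \<bar>t\<bar> powr (p - 1 - 1)) = w t"
      by (auto simp: w_def)
    ultimately show ?thesis
      unfolding h_def[abs_def] h'_def by (simp only: add.commute)
  qed
  have G_der: "((\<lambda>x. \<bar>u x\<bar> powr p * h (x \<bullet> \<Phi>)) has_derivative (\<lambda>v. g x \<bullet> v)) (at x within ?S)"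
    if x: "x \<in> ?S" for x
  proof -
    have du: "((\<lambda>x. \<bar>u x\<bar> powr p) has_derivative
        (\<lambda>v. p * (\<bar>u x\<bar> powr (p - 1) * sgn (u x)) * (sphere_gradient u x \<bullet> v))) (at x within ?S)"
      using has_derivative_compose[OF has_derivative_sphere_gradient[OF u x]
          DERIV_abs_powr[of p "u x", unfolded has_field_derivative_def]] p by simp
    have "((\<lambda>x. x \<bullet> \<Phi>) has_derivative (\<lambda>v. v \<bullet> \<Phi>)) (at x within ?S)"
      by (auto intro!: derivative_eq_intros)
    then have dh: "((\<lambda>x. h (x \<bullet> \<Phi>)) has_derivative (\<lambda>v. h' (x \<bullet> \<Phi>) * (v \<bullet> \<Phi>))) (at x within ?S)"
      using has_derivative_compose h_der[OF D0[OF x], unfolded has_field_derivative_def] by blast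
    show ?thesis
      by (rule has_derivative_eq_rhs[OF has_derivative_mult[OF du dh]])
         (simp add: g_def fun_eq_iff inner_add_left inner_commute[of \<Phi>] algebra_simps)
  qed
  \<comment> \<open>The regularization enters only through
    \<open>sqrt (1 - s\<^sup>2) \<le> sqrt d\<close> and \<open>(1 - s\<^sup>2) / d \<le> 1\<close>.
    Both point in the required direction, so the constants do not depend on
    \<open>e\<close>.\<close>
  have pt: "g x \<bullet> (\<Phi> - (x \<bullet> \<Phi>) *\<^sub>R x) \<le> p * (?a x * b x powr (p - 1)) + (p - 1) * K x + p * b x powr p"
    and sG: "(x \<bullet> \<Phi>) * (\<bar>u x\<bar> powr p * h (x \<bullet> \<Phi>)) = b x powr p"
    if x: "x \<in> ?S" for x
  proof -
    define s where "s = x \<bullet> \<Phi>"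
    define d where "d = D s"
    have d: "0 < d" "1 - s\<^sup>2 \<le> d" "0 \<le> 1 - s\<^sup>2" using D0[OF x] D1[OF x] s1[OF x] by (auto simp: d_def s_def)
    have b_powr: "b x powr q = \<bar>u x\<bar> powr q * \<bar>s\<bar> powr q * d powr (- q / 2)" for q
    proof -
      have "sqrt d powr q = d powr (q / 2)"
        using d by (simp add: powr_half_sqrt[symmetric] powr_powr)
      then show ?thesis
        using d by (simp add: b_def powr_divide powr_mult powr_minus field_simps flip: s_def d_def)
    qed
    have "s * (sgn s * \<bar>s\<bar> powr (p - 1)) = \<bar>s\<bar> powr p"
      by (cases "s = 0") (auto simp: powr_diff sgn_if)
    then show "(x \<bullet> \<Phi>) * (\<bar>u x\<bar> powr p * h (x \<bullet> \<Phi>)) = b x powr p"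
      by (simp add: b_powr h_def mult.left_commute mult.commute[of _ "sgn s"] flip: s_def d_def)
    have tx: "sphere_gradient u x \<bullet> x = 0" by (rule sphere_gradient_tangent[OF u x])
    have xx: "x \<bullet> x = 1" "\<Phi> \<bullet> \<Phi> = 1" using x n\<Phi> by (auto simp: dot_square_norm)
    have "g x \<bullet> (\<Phi> - s *\<^sub>R x) = p * (\<bar>u x\<bar> powr (p - 1) * sgn (u x)) * h s
          * (sphere_gradient u x \<bullet> (\<Phi> - s *\<^sub>R x)) + \<bar>u x\<bar> powr p * h' s * (1 - s\<^sup>2)"
      by (simp add: g_def inner_add_left inner_diff_right xx tx power2_eq_square inner_commute[of \<Phi> x]
          algebra_simps flip: s_def)
    also have "p * (\<bar>u x\<bar> powr (p - 1) * sgn (u x)) * h s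
          * (sphere_gradient u x \<bullet> (\<Phi> - s *\<^sub>R x)) \<le> p * (?a x * b x powr (p - 1))"
    proof -
      have "norm (\<Phi> - s *\<^sub>R x) = sqrt (1 - s\<^sup>2)"
        by (simp add: norm_eq_sqrt_inner inner_diff_left inner_diff_right xx inner_commute[of \<Phi> x]
            power2_eq_square flip: s_def)
      also have "\<dots> \<le> sqrt d" using d by simp
      finally have "\<bar>sphere_gradient u x \<bullet> (\<Phi> - s *\<^sub>R x)\<bar> \<le> ?a x * sqrt d"
        using Cauchy_Schwarz_ineq2 norm_ge_zero mult_left_mono order_trans by metis
      moreover have "\<bar>p * (\<bar>u x\<bar> powr (p - 1) * sgn (u x)) * h s\<bar>
          \<le> p * (\<bar>u x\<bar> powr (p - 1) * (\<bar>s\<bar> powr (p - 1) * d powr (- p / 2)))"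
        using p by (auto simp: h_def abs_mult sgn_if simp flip: d_def)
      ultimately have "\<bar>p * (\<bar>u x\<bar> powr (p - 1) * sgn (u x)) * h s\<bar> * \<bar>sphere_gradient u x \<bullet> (\<Phi> - s *\<^sub>R x)\<bar>
          \<le> p * (\<bar>u x\<bar> powr (p - 1) * (\<bar>s\<bar> powr (p - 1) * d powr (- p / 2))) * (?a x * sqrt d)"
        using p by (intro mult_mono) auto
      also have "\<dots> = p * (?a x * (\<bar>u x\<bar> powr (p - 1) * \<bar>s\<bar> powr (p - 1) * (d powr (- p / 2) * d powr (1 / 2))))"
        using d by (simp add: powr_half_sqrt)
      \<comment> \<open>The bound \<open>sqrt d\<close> for the norm of the tangential field turns
        the exponent of \<open>d\<close> into the one in \<open>b x powr (p - 1)\<close>.\<close>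
      also have "d powr (- p / 2) * d powr (1 / 2) = d powr (- (p - 1) / 2)"
        by (simp add: powr_add[symmetric] diff_divide_distrib)
      finally show ?thesis
        unfolding b_powr abs_mult[symmetric] by linarith
    qed
    also have "\<bar>u x\<bar> powr p * h' s * (1 - s\<^sup>2) \<le> (p - 1) * K x + p * b x powr p"
    proof -
      have 1: "d powr (- p / 2 - 1) * (1 - s\<^sup>2) \<le> d powr (- p / 2)"
      proof -
        have "d powr (- p / 2 - 1) * (1 - s\<^sup>2) = d powr (- p / 2) * ((1 - s\<^sup>2) / d)"
          using d by (simp add: powr_diff)
        also have "\<dots> \<le> d powr (- p / 2) * 1"
          using d by (intro mult_left_mono) auto
        finally show ?thesis by simp
      qed
      have 2: "d powr (- p / 2) * (1 - s\<^sup>2) = (1 - s\<^sup>2) / d powr (p / 2)"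
        by (simp add: powr_minus field_simps)
      have "\<bar>u x\<bar> powr p * h' s * (1 - s\<^sup>2)
          = (p - 1) * (\<bar>u x\<bar> powr p * w s * (d powr (- p / 2) * (1 - s\<^sup>2)))
            + p * (\<bar>u x\<bar> powr p * \<bar>s\<bar> powr p * (d powr (- p / 2 - 1) * (1 - s\<^sup>2)))"
        unfolding h'_def d_def by (simp add: algebra_simps)
      also have "(p - 1) * (\<bar>u x\<bar> powr p * w s * (d powr (- p / 2) * (1 - s\<^sup>2))) = (p - 1) * K x"
        unfolding 2 by (simp add: K_def flip: s_def d_def)
      also have "p * (\<bar>u x\<bar> powr p * \<bar>s\<bar> powr p * (d powr (- p / 2 - 1) * (1 - s\<^sup>2))) \<le> p * b x powr p"
        unfolding b_powr using p by (intro mult_left_mono 1) auto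
      finally show ?thesis by simp
    qed
    finally show "g x \<bullet> (\<Phi> - (x \<bullet> \<Phi>) *\<^sub>R x) \<le> p * (?a x * b x powr (p - 1)) + (p - 1) * K x + p * b x powr p"
      by (simp flip: s_def)
  qed
  \<comment> \<open>Young's inequality is applied to \<open>?a x\<close> and
    \<open>\<gamma> * b x\<close>. Multiplying by \<open>\<gamma> powr (p - 1)\<close> beforehand
    gives the gradient term the coefficient 1.\<close>
  have young: "\<gamma> powr (p - 1) * (g x \<bullet> (\<Phi> - (x \<bullet> \<Phi>) *\<^sub>R x))
      \<le> ?a x powr p + (p - 1) * \<gamma> powr (p - 1) * K x + (p - 1 + p / \<gamma>) * \<gamma> powr p * b x powr p"
    if x: "x \<in> ?S" for x
  proof -
    have "\<gamma> powr (p - 1) * (g x \<bullet> (\<Phi> - (x \<bullet> \<Phi>) *\<^sub>R x)) \<le>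
        \<gamma> powr (p - 1) * (p * (?a x * b x powr (p - 1)) + (p - 1) * K x + p * b x powr p)"
      by (intro mult_left_mono pt[OF x]) auto
    also have "\<dots> = p * (?a x * (\<gamma> * b x) powr (p - 1)) + (p - 1) * \<gamma> powr (p - 1) * K x
        + p * \<gamma> powr (p - 1) * b x powr p"
      using \<gamma> b0[OF x] by (simp add: powr_mult algebra_simps)
    also have "p * (?a x * (\<gamma> * b x) powr (p - 1)) \<le> ?a x powr p + (p - 1) * (\<gamma> * b x) powr p"
      using \<gamma> b0[OF x] p by (intro Youngs_inequality_weight) auto
    also have "(\<gamma> * b x) powr p = \<gamma> powr p * b x powr p"
      using \<gamma> b0[OF x] by (simp add: powr_mult)
    also have "\<gamma> powr (p - 1) = \<gamma> powr p / \<gamma>" using \<gamma> by (simp add: powr_diff)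
    finally show ?thesis
      using \<gamma> by (simp add: powr_diff algebra_simps)
  qed
  let ?A = "LINT x|sphere_measure. ?a x powr p"
  let ?B = "LINT x|sphere_measure. b x powr p"
  let ?K = "LINT x|sphere_measure. K x"
  note int = integrable_sphere_measure
  have "(real DIM('a) - 1) * (\<gamma> powr (p - 1) * ?B) = \<gamma> powr (p - 1) *
      ((real DIM('a) - 1) * (LINT x|sphere_measure. (x \<bullet> \<Phi>) * (\<bar>u x\<bar> powr p * h (x \<bullet> \<Phi>))))"
  proof -
    have "?B = (LINT x|sphere_measure. (x \<bullet> \<Phi>) * (\<bar>u x\<bar> powr p * h (x \<bullet> \<Phi>)))"
      by (intro Bochner_Integration.integral_cong refl sG[symmetric]) simp
    then show ?thesis by simp
  qed
  also have "\<dots> = (LINT x|sphere_measure. \<gamma> powr (p - 1) * (g x \<bullet> (\<Phi> - (x \<bullet> \<Phi>) *\<^sub>R x)))"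
  proof -
    have "(LINT x|sphere_measure. g x \<bullet> (\<Phi> - (x \<bullet> \<Phi>) *\<^sub>R x)) = (real DIM('a) - 1) *
        (LINT x|sphere_measure. (x \<bullet> \<Phi>) * (\<bar>u x\<bar> powr p * h (x \<bullet> \<Phi>)))"
      by (rule integral_sphere_by_parts[OF _ cgg n\<Phi>]) (rule G_der)
    then show ?thesis by simp
  qed
  also have "\<dots> \<le> (LINT x|sphere_measure. ?a x powr p + (p - 1) * \<gamma> powr (p - 1) * K x
      + (p - 1 + p / \<gamma>) * \<gamma> powr p * b x powr p)"
    using young
    by (intro integral_mono int continuous_on_add continuous_on_mult continuous_on_const
        continuous_on_inner continuous_on_diff continuous_on_scaleR continuous_on_id
        ca cbp cK cgg) auto
  also have "\<dots> = ?A + (p - 1) * \<gamma> powr (p - 1) * ?K + (p - 1 + p / \<gamma>) * \<gamma> powr p * ?B"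
    by (simp add: int[OF ca] int[OF cbp] int[OF cK])
  \<comment> \<open>Because \<open>DIM('a) - 1 = p * \<gamma> + p\<close>, this coefficient of
    \<open>?B\<close> falls short of the one on the left of the chain by exactly
    \<open>\<gamma> powr p\<close>, the constant claimed.\<close>
  also have "(p - 1 + p / \<gamma>) * \<gamma> powr p * ?B = (real DIM('a) - 1) * (\<gamma> powr (p - 1) * ?B) - \<gamma> powr p * ?B"
  proof -
    have "real DIM('a) - 1 = p * \<gamma> + p" using p\<gamma> by simp
    then show ?thesis using \<gamma> by (simp add: powr_diff field_simps)
  qed
  finally have "\<gamma> powr p * ?B \<le> ?A + (p - 1) * \<gamma> powr (p - 1) * ?K" by simp
  then show ?thesis unfolding b_def K_def w_def D_def .
qed

section \<open>Removing the regularization\<close>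

lemma sphere_inner_bounds:
  fixes x y :: "'a::euclidean_space"
  assumes "x \<in> sphere 0 1" "y \<in> sphere 0 1"
  shows "-1 \<le> x \<bullet> y" "x \<bullet> y \<le> 1" "(x \<bullet> y)\<^sup>2 \<le> 1"
proof -
  have "\<bar>x \<bullet> y\<bar> \<le> 1" using Cauchy_Schwarz_ineq2[of x y] assms by simp
  then show "-1 \<le> x \<bullet> y" "x \<bullet> y \<le> 1" "(x \<bullet> y)\<^sup>2 \<le> 1" by (auto simp: abs_square_le_1)
qed

text \<open>Since \<open>sin (arccos s) = sqrt (1 - s\<^sup>2)\<close>, the weight becomes algebraic
  in \<open>x \<bullet> y\<close>. At the poles division by zero makes it 0 for
  \<open>q \<noteq> 0\<close>.\<close>

lemma inv_abs_tan_powr_sphere_dist: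
  assumes "x \<in> sphere 0 1" "y \<in> sphere 0 1"
  shows "inv_abs_tan_powr (sphere_dist x y) q =
    (if q = 0 then 1 else (\<bar>x \<bullet> y\<bar> / sqrt (1 - (x \<bullet> y)\<^sup>2)) powr q)"
  using sphere_inner_bounds[OF assms]
  by (simp add: inv_abs_tan_powr_def sphere_dist_def cos_arccos sin_arccos)

text \<open>The regularized inequality is used with \<open>e\<close> running through
  \<open>1 / real (Suc n)\<close>. Fatou's lemma handles the left side; on the right,
  \<open>K_le\<close> bounds the regularized weight by the true one for every \<open>n\<close>. With
  nonnegative integrals the singular weights call for no prior integrability.\<close>

theorem sphere_hardy:
  fixes \<Phi> :: "'a::euclidean_space" and u :: "'a \<Rightarrow> real" and p :: real
  defines "\<gamma> \<equiv> (real DIM('a) - 1 - p) / p"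
  assumes p: "2 \<le> p" "p < real DIM('a) - 1" and \<Phi>: "\<Phi> \<in> sphere 0 1"
    and u: "smooth_on_sphere u"
  shows "ennreal (\<gamma> powr p) * (\<integral>\<^sup>+x. ennreal (\<bar>u x\<bar> powr p * inv_abs_tan_powr (sphere_dist x \<Phi>) p)
        \<partial>sphere_measure)
    \<le> (\<integral>\<^sup>+x. ennreal (norm (sphere_gradient u x) powr p) \<partial>sphere_measure)
      + ennreal ((p - 1) * \<gamma> powr (p - 1))
        * (\<integral>\<^sup>+x. ennreal (\<bar>u x\<bar> powr p * inv_abs_tan_powr (sphere_dist x \<Phi>) (p - 2)) \<partial>sphere_measure)"
    (is "?c * ?L \<le> ?R")
proof -
  have \<gamma>: "0 < \<gamma>" using p by (simp add: \<gamma>_def)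
  define e where "e n = 1 / real (Suc n)" for n
  have e0: "0 < e n" for n by (simp add: e_def)
  define b where "b n x = (\<bar>u x\<bar> * \<bar>x \<bullet> \<Phi>\<bar> / sqrt (1 - (x \<bullet> \<Phi>)\<^sup>2 + e n)) powr p" for n x
  define K where "K n x = \<bar>u x\<bar> powr p * (if p = 2 then 1 else \<bar>x \<bullet> \<Phi>\<bar> powr (p - 2))
            * ((1 - (x \<bullet> \<Phi>)\<^sup>2) / (1 - (x \<bullet> \<Phi>)\<^sup>2 + e n) powr (p / 2))" for n x
  let ?S = "sphere (0::'a) 1"
  have cu: "continuous_on ?S u"
    using has_derivative_sphere_gradient[OF u] has_derivative_continuous
      continuous_on_eq_continuous_within by blast
  note s1 = sphere_inner_bounds(3)[OF _ \<Phi>]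
  have D0: "0 < 1 - (x \<bullet> \<Phi>)\<^sup>2 + e n" if "x \<in> ?S" for x n
    using s1[OF that] e0[of n] by linarith
  have cD: "continuous_on ?S (\<lambda>x. 1 - (x \<bullet> \<Phi>)\<^sup>2 + e n)" for n
    by (intro continuous_intros)
  have cb: "continuous_on ?S (b n)" for n
  proof -
    have "sqrt (1 - (x \<bullet> \<Phi>)\<^sup>2 + e n) \<noteq> 0" if "x \<in> ?S" for x using D0[OF that, of n] by simp
    then show ?thesis
      unfolding b_def using p D0
      by (intro continuous_on_powr' continuous_on_divide continuous_on_mult continuous_on_rabs
          continuous_on_real_sqrt continuous_on_inner continuous_on_const continuous_on_id cu cD)
         (auto simp: less_imp_le)
  qed
  have cK: "continuous_on ?S (K n)" for n
  proof -
    have "continuous_on ?S (\<lambda>x. \<bar>u x\<bar> powr p)"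
      using p by (intro continuous_on_abs_powr cu) auto
    moreover have "continuous_on ?S (\<lambda>x. if p = 2 then 1 else \<bar>x \<bullet> \<Phi>\<bar> powr (p - 2))"
      using p by (cases "p = 2") (auto intro!: continuous_on_abs_powr continuous_intros)
    moreover have "continuous_on ?S
        (\<lambda>x. (1 - (x \<bullet> \<Phi>)\<^sup>2) / (1 - (x \<bullet> \<Phi>)\<^sup>2 + e n) powr (p / 2))"
    proof -
      have "1 - (x \<bullet> \<Phi>)\<^sup>2 + e n \<noteq> 0" if "x \<in> ?S" for x using D0[OF that, of n] by simp
      then show ?thesis by (intro continuous_intros) auto
    qed
    ultimately show ?thesis unfolding K_def by (intro continuous_on_mult)
  qed
  have ca: "continuous_on ?S (\<lambda>x. norm (sphere_gradient u x) powr p)"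
    using p by (intro continuous_on_powr' continuous_intros continuous_on_sphere_gradient[OF u]) auto
  have K0: "0 \<le> K n x" if "x \<in> ?S" for n x
    using s1[OF that] by (simp add: K_def)
  have nn: "(\<integral>\<^sup>+x. ennreal (f x) \<partial>sphere_measure) = ennreal (LINT x|sphere_measure. f x)"
    if "continuous_on ?S f" "\<And>x. x \<in> ?S \<Longrightarrow> 0 \<le> f x" for f :: "'a \<Rightarrow> real"
    using that by (intro nn_integral_eq_integral integrable_sphere_measure AE_I2) auto
  have K_le: "K n x \<le> \<bar>u x\<bar> powr p * inv_abs_tan_powr (sphere_dist x \<Phi>) (p - 2)" if x: "x \<in> ?S" for n x
  proof -
    define t where "t = 1 - (x \<bullet> \<Phi>)\<^sup>2"
    have t: "0 \<le> t" using s1[OF x] by (simp add: t_def)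
    \<comment> \<open>Dropping \<open>e n\<close> from the denominator enlarges the quotient; at the
      poles \<open>t = 0\<close> and both sides are 0.\<close>
    have "t / (t + e n) powr (p / 2) \<le> t / t powr (p / 2)"
    proof (cases "t = 0")
      case False
      then show ?thesis
        using t e0[of n] p by (intro divide_left_mono powr_mono2 mult_pos_pos) auto
    qed simp
    also have "\<dots> = (if t = 0 then 0 else 1 / sqrt t powr (p - 2))"
      using t by (auto simp: powr_half_sqrt[symmetric] powr_powr diff_divide_distrib powr_diff)
    finally have "t / (t + e n) powr (p / 2) \<le> (if t = 0 then 0 else 1 / sqrt t powr (p - 2))" .
    then have "(if p = 2 then 1 else \<bar>x \<bullet> \<Phi>\<bar> powr (p - 2)) * (t / (t + e n) powr (p / 2)) \<le>
        (if p = 2 then 1 else \<bar>x \<bullet> \<Phi>\<bar> powr (p - 2)) * (if t = 0 then 0 else 1 / sqrt t powr (p - 2))"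
      by (intro mult_left_mono) auto
    also have "\<dots> \<le> inv_abs_tan_powr (sphere_dist x \<Phi>) (p - 2)"
      unfolding inv_abs_tan_powr_sphere_dist[OF x \<Phi>]
      using t by (auto simp: powr_divide simp flip: t_def)
    finally show ?thesis
      unfolding K_def t_def mult.assoc by (intro mult_left_mono) auto
  qed
  have b_lim: "ennreal (\<bar>u x\<bar> powr p * inv_abs_tan_powr (sphere_dist x \<Phi>) p) \<le> liminf (\<lambda>n. ennreal (b n x))"
    if x: "x \<in> ?S" for x
  proof (cases "(x \<bullet> \<Phi>)\<^sup>2 = 1")
    \<comment> \<open>At the poles the true weight is 0 by division by zero, so the bound is
      trivial.\<close>
    case True
    then show ?thesis using p by (simp add: inv_abs_tan_powr_sphere_dist[OF x \<Phi>])
  next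
    case False
    then have t: "0 < 1 - (x \<bullet> \<Phi>)\<^sup>2" using s1[OF x] by simp
    have "e \<longlonglongrightarrow> 0"
      unfolding e_def using LIMSEQ_inverse_real_of_nat by (simp add: inverse_eq_divide)
    then have lim: "(\<lambda>n. sqrt (1 - (x \<bullet> \<Phi>)\<^sup>2 + e n)) \<longlonglongrightarrow> sqrt (1 - (x \<bullet> \<Phi>)\<^sup>2 + 0)"
      by (intro tendsto_intros)
    have "(\<lambda>n. b n x) \<longlonglongrightarrow> (\<bar>u x\<bar> * \<bar>x \<bullet> \<Phi>\<bar> / sqrt (1 - (x \<bullet> \<Phi>)\<^sup>2 + 0)) powr p"
      unfolding b_def using p t D0[OF x]
      by (intro tendsto_powr' tendsto_divide tendsto_const lim) (auto simp: less_imp_le)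
    moreover have "(\<bar>u x\<bar> * \<bar>x \<bullet> \<Phi>\<bar> / sqrt (1 - (x \<bullet> \<Phi>)\<^sup>2 + 0)) powr p
        = \<bar>u x\<bar> powr p * inv_abs_tan_powr (sphere_dist x \<Phi>) p"
      using p t by (simp add: inv_abs_tan_powr_sphere_dist[OF x \<Phi>] powr_divide powr_mult)
    ultimately have "(\<lambda>n. ennreal (b n x)) \<longlonglongrightarrow>
        ennreal (\<bar>u x\<bar> powr p * inv_abs_tan_powr (sphere_dist x \<Phi>) p)"
      by (simp add: tendsto_ennrealI)
    then show ?thesis by (simp add: lim_imp_Liminf)
  qed
  \<comment> \<open>The regularized integrals are finite, so the real inequality carries over to
    \<open>ennreal\<close> before \<open>K n\<close> is replaced by its bound.\<close>
  have step: "?c * (\<integral>\<^sup>+x. ennreal (b n x) \<partial>sphere_measure) \<le> ?R" for n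
  proof -
    have "?c * (\<integral>\<^sup>+x. ennreal (b n x) \<partial>sphere_measure)
        = ennreal (\<gamma> powr p * (LINT x|sphere_measure. b n x))"
      by (subst nn[OF cb]) (auto simp: b_def ennreal_mult')
    also have "\<dots> \<le> ennreal ((LINT x|sphere_measure. norm (sphere_gradient u x) powr p)
        + (p - 1) * \<gamma> powr (p - 1) * (LINT x|sphere_measure. K n x))"
      unfolding b_def K_def \<gamma>_def by (intro ennreal_leI sphere_hardy_regularized p \<Phi> u e0)
    also have "\<dots> = (\<integral>\<^sup>+x. ennreal (norm (sphere_gradient u x) powr p) \<partial>sphere_measure)
        + ennreal ((p - 1) * \<gamma> powr (p - 1)) * (\<integral>\<^sup>+x. ennreal (K n x) \<partial>sphere_measure)"
    proof -
      have "0 \<le> (LINT x|sphere_measure. K n x)"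
        using K0 by (intro Bochner_Integration.integral_nonneg_AE AE_I2) simp
      moreover have "(\<integral>\<^sup>+x. ennreal (K n x) \<partial>sphere_measure) = ennreal (LINT x|sphere_measure. K n x)"
        by (rule nn[OF cK K0])
      ultimately show ?thesis
        using p by (simp add: nn[OF ca] ennreal_mult ennreal_plus)
    qed
    also have "\<dots> \<le> ?R"
      using K_le by (intro add_left_mono mult_left_mono nn_integral_mono ennreal_leI) auto
    finally show ?thesis .
  qed
  \<comment> \<open>The constant is positive and finite, so it can be divided out, Fatou's lemma
    applied to the bare integrals, and the constant multiplied back.\<close>
  have c: "?c \<noteq> 0" "?c \<noteq> top" using \<gamma> by (auto simp: ennreal_eq_0_iff)
  have "?L \<le> (\<integral>\<^sup>+x. liminf (\<lambda>n. ennreal (b n x)) \<partial>sphere_measure)"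
    using b_lim by (intro nn_integral_mono) simp
  also have "\<dots> \<le> liminf (\<lambda>n. \<integral>\<^sup>+x. ennreal (b n x) \<partial>sphere_measure)"
    by (intro nn_integral_liminf measurable_compose[OF borel_measurable_sphere_measure[OF cb]]) simp
  also have "\<dots> \<le> ?R / ?c"
  proof (intro Liminf_le always_eventually allI)
    show "(\<integral>\<^sup>+x. ennreal (b n x) \<partial>sphere_measure) \<le> ?R / ?c" for n
      using divide_right_mono_ennreal[OF step[of n], of ?c] c
      by (simp add: ennreal_mult_divide_eq mult.commute[of ?c])
  qed simp
  finally have "?c * ?L \<le> ?c * (?R / ?c)" by (rule mult_left_mono) simp
  also have "\<dots> = ?R"
    using c by (simp add: ennreal_times_divide ennreal_mult_divide_eq mult.commute[of ?c])
  finally show ?thesis .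
qed

theorem mainTheorem1:
  fixes n :: nat and p :: real
    and \<Phi> :: "real ^ 'm::finite" and u :: "real ^ 'm \<Rightarrow> real"
  assumes "CARD('m) = n + 1" and "n \<ge> 3" and "2 \<le> p" and "p < real n"
    and "\<Phi> \<in> sphere 0 1"
    and "smooth_on_sphere u"
  shows
    "(\<integral>\<^sup>+x. ennreal (norm (sphere_gradient u x) powr p) \<partial>sphere_measure)
       + ennreal ((p - 1) * ((real n - p) / p) powr (p - 1))
         * (\<integral>\<^sup>+x. ennreal (\<bar>u x\<bar> powr p * inv_abs_tan_powr (sphere_dist x \<Phi>) (p - 2))
              \<partial>sphere_measure)
     \<ge> ennreal (((real n - p) / p) powr p)
         * (\<integral>\<^sup>+x. ennreal (\<bar>u x\<bar> powr p * inv_abs_tan_powr (sphere_dist x \<Phi>) p)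
              \<partial>sphere_measure)"
proof -
  \<comment> \<open>The sphere has one dimension less than the ambient space, so
    \<open>\<gamma>\<close> in \<open>sphere_hardy\<close> becomes
    \<open>(real n - p) / p\<close>.\<close>
  have "real DIM(real ^ 'm) - 1 = real n" using assms(1) by simp
  then show ?thesis using sphere_hardy[of p \<Phi> u] assms by simp
qed

end
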